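(* Let $(x,s)\in\mathcal{C}$ be a feasible first-stage decision and let $\xi\in\mathbb{Z}_{\ge0}^{|\mathcal{A}|}$ be a realization of demand. Given an index $\hat i\in\mathcal{I}$, assume that $$\sum_{v\in\mathcal{V}}s_{v\hat i}\ge\sum_{j:(\hat i,j)\in\mathcal{A}}\xi_{\hat ij}.$$ Then the optimal solution to the problem $Q^{\hat i}(x,s,\xi)$ of the recourse problem with proportional vehicle assignment, namely $$\max\sum_{j\in\mathcal{J}_{\hat i}}\sum_{l\in\mathcal{L}}P_{\hat ijl}r_{jl}\ \text{ s.t. }\ r_{jl}\le\xi_{\hat ij}x_{\zeta(\hat i),\zeta(j),l},\ \ r_{jl}\le\theta_{\hat ij}\sum_{v\in\mathcal{V}}s_{v\hat i}+1,\ \ r_{jl}\in\mathbb{Z}_{\ge0}\ \ \forall j\in\mathcal{J}_{\hat i},\,l\in\mathcal{L};\quad\sum_{(j,l)\in\mathcal{J}_{\hat i}\times\mathcal{L}}r_{jl}\le\sum_{v\in\mathcal{V}}s_{v\hat i},$$ denoted $\hat r=(\hat r_{jl})_{j\in\mathcal{J}_{\hat i},l\in\mathcal{L}}$, is $$\hat r_{jl}=\xi_{\hat ij}x_{\zeta(\hat i),\zeta(j),l}\qquad\forall j\in\mathcal{J}_{\hat i},\ \forall l\in\mathcal{L}.$$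
   Context: $\mathcal{I}$ (stations), $\mathcal{Z}$ (zones), $\mathcal{L}$ (price levels), $\mathcal{V}$ (vehicles) are finite sets. $\mathcal{A}=\{(i,j): i,j\in\mathcal{I},\ i\ne j\}$. The stations are partitioned into zones, and $\zeta:\mathcal{I}\to\mathcal{Z}$ maps a station to its zone. $\mathcal{J}_i=\{j\in\mathcal{I}:(i,j)\in\mathcal{A}\}$. $P_{ijl}$ is the rental price from station $i$ to station $j$ at price level $l$. $\xi_{ij}$ is the demand on arc $(i,j)$, and $\theta_{ij}=\xi_{ij}/\sum_{k\in\mathcal{I}:k\ne i}\xi_{ik}$ is the fraction of the demand from station $i$ directed to station $j$. $\mathcal{C}$ is the set of pairs $(x,s)$ with $x=(x_{z_1,z_2,l})\in\{0,1\}^{|\mathcal{Z}|\times|\mathcal{Z}|\times|\mathcal{L}|}$ and $s=(s_{vi})\in\{0,1\}^{|\mathcal{V}|\times|\mathcal{I}|}$ such that $\sum_{l\in\mathcal{L}}x_{z_1,z_2,l}=1$ for all $z_1,z_2\in\mathcal{Z}$ and $\sum_{i\in\mathcal{I}}s_{vi}=1$ for all $v\in\mathcal{V}$.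
   Formalization: Rental prices are assumed nonnegative (the claim fails for negative prices), and uniqueness of the optimal solution is asserted only at the entries (j,l) whose price is positive, since at zero price the optimum need not be unique. *)

theory Defs
  imports Complex_Main
begin

text \<open>
  Index sets: stations \<open>I\<close>, zones \<open>Z\<close>, price levels \<open>L\<close>, vehicles \<open>V\<close>. Indexed families are
  represented by total functions whose values outside the index sets are irrelevant.
\<close>

definition arcs :: "'i set \<Rightarrow> ('i \<times> 'i) set" where
  "arcs I = {(i, j). i \<in> I \<and> j \<in> I \<and> i \<noteq> j}"

definition dests :: "'i set \<Rightarrow> 'i \<Rightarrow> 'i set" where
  "dests I i = {j \<in> I. (i, j) \<in> arcs I}"

definition first_stage ::
  "'i set \<Rightarrow> 'z set \<Rightarrow> 'l set \<Rightarrow> 'v set \<Rightarrow>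
    (('z \<Rightarrow> 'z \<Rightarrow> 'l \<Rightarrow> nat) \<times> ('v \<Rightarrow> 'i \<Rightarrow> nat)) set" where
  "first_stage I Z L V = {(x, s).
     (\<forall>z1\<in>Z. \<forall>z2\<in>Z. \<forall>l\<in>L. x z1 z2 l \<in> {0, 1}) \<and>
     (\<forall>v\<in>V. \<forall>i\<in>I. s v i \<in> {0, 1}) \<and>
     (\<forall>z1\<in>Z. \<forall>z2\<in>Z. (\<Sum>l\<in>L. x z1 z2 l) = 1) \<and>
     (\<forall>v\<in>V. (\<Sum>i\<in>I. s v i) = 1)}"

text \<open>If there is no demand from \<open>i\<close> at all, the quotient is \<open>0 / 0 = 0\<close>.\<close>

definition demand_fraction :: "'i set \<Rightarrow> ('i \<times> 'i \<Rightarrow> nat) \<Rightarrow> 'i \<Rightarrow> 'i \<Rightarrow> real" where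
  "demand_fraction I \<xi> i j = real (\<xi> (i, j)) / (\<Sum>k\<in>{k \<in> I. k \<noteq> i}. real (\<xi> (i, k)))"

text \<open>
  The recourse problem at station \<open>i\<close>; the constraint that the entries of \<open>r\<close> be nonnegative
  integers is carried by the type.
\<close>

definition recourse_feasible ::
  "'i set \<Rightarrow> 'l set \<Rightarrow> 'v set \<Rightarrow> ('i \<Rightarrow> 'z) \<Rightarrow> ('z \<Rightarrow> 'z \<Rightarrow> 'l \<Rightarrow> nat) \<Rightarrow> ('v \<Rightarrow> 'i \<Rightarrow> nat) \<Rightarrow>
    ('i \<times> 'i \<Rightarrow> nat) \<Rightarrow> 'i \<Rightarrow> ('i \<Rightarrow> 'l \<Rightarrow> nat) set" where
  "recourse_feasible I L V \<zeta> x s \<xi> i = {r.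
     (\<forall>j\<in>dests I i. \<forall>l\<in>L. r j l \<le> \<xi> (i, j) * x (\<zeta> i) (\<zeta> j) l) \<and>
     (\<forall>j\<in>dests I i. \<forall>l\<in>L.
        real (r j l) \<le> demand_fraction I \<xi> i j * (\<Sum>v\<in>V. real (s v i)) + 1) \<and>
     (\<Sum>(j, l)\<in>dests I i \<times> L. r j l) \<le> (\<Sum>v\<in>V. s v i)}"

definition recourse_objective ::
  "'i set \<Rightarrow> 'l set \<Rightarrow> ('i \<Rightarrow> 'i \<Rightarrow> 'l \<Rightarrow> real) \<Rightarrow> 'i \<Rightarrow> ('i \<Rightarrow> 'l \<Rightarrow> nat) \<Rightarrow> real" where
  "recourse_objective I L P i r = (\<Sum>j\<in>dests I i. \<Sum>l\<in>L. P i j l * real (r j l))"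

definition recourse_optimal ::
  "'i set \<Rightarrow> 'l set \<Rightarrow> 'v set \<Rightarrow> ('i \<Rightarrow> 'z) \<Rightarrow> ('i \<Rightarrow> 'i \<Rightarrow> 'l \<Rightarrow> real) \<Rightarrow>
    ('z \<Rightarrow> 'z \<Rightarrow> 'l \<Rightarrow> nat) \<Rightarrow> ('v \<Rightarrow> 'i \<Rightarrow> nat) \<Rightarrow> ('i \<times> 'i \<Rightarrow> nat) \<Rightarrow> 'i \<Rightarrow>
    ('i \<Rightarrow> 'l \<Rightarrow> nat) \<Rightarrow> bool" where
  "recourse_optimal I L V \<zeta> P x s \<xi> i r \<longleftrightarrow>
     is_arg_max (recourse_objective I L P i) (\<lambda>r. r \<in> recourse_feasible I L V \<zeta> x s \<xi> i) r"

end

theory Submission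
  imports Defs
begin

text \<open>
  Every price is nonnegative, so raising an entry of \<open>r\<close> never lowers the objective, and the demand
  bounds \<open>r j l \<le> \<xi> (i, j) * x (\<zeta> i) (\<zeta> j) l\<close> alone cap each entry. The point that attains all these
  caps at once is therefore optimal as soon as it is feasible, and any optimal point must attain
  the cap wherever the price is positive, since otherwise its value would be strictly smaller
  (\<open>recourse_objective_strict_mono\<close>).

  Feasibility is where the ample supply enters. Exactly one price level is active between any two
  zones, so the caps add up to the total demand from the station (\<open>sum_demand_caps\<close>), which the
  vehicles present cover. If the supply \<open>S\<close> is at least the total demand \<open>D > 0\<close>, then the proportional
  share \<open>(\<xi> (i, j) / D) * S\<close> of the vehicles is already at least \<open>\<xi> (i, j)\<close>
  (\<open>demand_le_proportional_share\<close>), so the proportional assignment constraint is implied by the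
  demand constraint.
\<close>

lemma dests_eq: "i \<in> I \<Longrightarrow> dests I i = {k \<in> I. k \<noteq> i}"
  by (auto simp: dests_def arcs_def)

lemma finite_dests: "finite I \<Longrightarrow> finite (dests I i)"
  by (simp add: dests_def)

text \<open>
  With \<open>D\<close> the total demand from \<open>i\<close>, the claim is \<open>\<xi> (i, j) * D \<le> \<xi> (i, j) * S\<close> divided by \<open>D\<close>. For
  \<open>D = 0\<close> the fraction is the default value \<open>0\<close>, but then \<open>\<xi> (i, j)\<close> vanishes as well.
\<close>

lemma demand_le_proportional_share:
  assumes "finite I" and "i \<in> I" and "j \<in> dests I i"
    and ample: "(\<Sum>k\<in>dests I i. real (\<xi> (i, k))) \<le> S"
  shows "real (\<xi> (i, j)) \<le> demand_fraction I \<xi> i j * S"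
proof -
  define D where "D = (\<Sum>k\<in>dests I i. real (\<xi> (i, k)))"
  have le: "real (\<xi> (i, j)) \<le> D"
    unfolding D_def using assms by (intro member_le_sum) (auto simp: finite_dests)
  have frac: "demand_fraction I \<xi> i j = real (\<xi> (i, j)) / D"
    using \<open>i \<in> I\<close> by (simp add: demand_fraction_def D_def dests_eq)
  show ?thesis
  proof (cases "D = 0")
    case True
    with le frac show ?thesis by simp
  next
    case False
    with le have "D > 0" by linarith
    then have "real (\<xi> (i, j)) * D \<le> real (\<xi> (i, j)) * S"
      using ample by (intro mult_left_mono) (auto simp: D_def)
    with \<open>D > 0\<close> show ?thesis by (simp add: frac field_simps)
  qed
qed

lemma sum_demand_caps:
  assumes "(x, s) \<in> first_stage I Z L V" and "\<zeta> ` I \<subseteq> Z" and "i \<in> I"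
  shows "(\<Sum>(j, l)\<in>dests I i \<times> L. \<xi> (i, j) * x (\<zeta> i) (\<zeta> j) l) = (\<Sum>j\<in>dests I i. \<xi> (i, j))"
proof -
  have one: "(\<Sum>l\<in>L. x (\<zeta> i) (\<zeta> j) l) = 1" if "j \<in> dests I i" for j
    using assms that by (auto simp: first_stage_def dests_def image_subset_iff)
  have "(\<Sum>(j, l)\<in>dests I i \<times> L. \<xi> (i, j) * x (\<zeta> i) (\<zeta> j) l)
      = (\<Sum>j\<in>dests I i. \<xi> (i, j) * (\<Sum>l\<in>L. x (\<zeta> i) (\<zeta> j) l))"
    by (simp add: sum.cartesian_product[symmetric] sum_distrib_left)
  also have "\<dots> = (\<Sum>j\<in>dests I i. \<xi> (i, j))"
    by (rule sum.cong) (simp_all only: one mult_1_right)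
  finally show ?thesis .
qed

text \<open>
  Since \<open>x\<close> is binary, each cap is at most \<open>\<xi> (i, j)\<close>, which the proportional share covers,
  and the caps add up to the total demand, which the vehicles at \<open>i\<close> cover.
\<close>

lemma demand_caps_feasible:
  assumes "finite I" and "\<zeta> ` I \<subseteq> Z" and xs: "(x, s) \<in> first_stage I Z L V" and "i \<in> I"
    and ample: "(\<Sum>j\<in>dests I i. \<xi> (i, j)) \<le> (\<Sum>v\<in>V. s v i)"
  shows "(\<lambda>j l. \<xi> (i, j) * x (\<zeta> i) (\<zeta> j) l) \<in> recourse_feasible I L V \<zeta> x s \<xi> i"
proof -
  have "real (\<xi> (i, j) * x (\<zeta> i) (\<zeta> j) l)
      \<le> demand_fraction I \<xi> i j * (\<Sum>v\<in>V. real (s v i)) + 1"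
    if "j \<in> dests I i" "l \<in> L" for j l
  proof -
    have "(\<Sum>k\<in>dests I i. real (\<xi> (i, k))) \<le> (\<Sum>v\<in>V. real (s v i))"
      using ample by (metis of_nat_le_iff of_nat_sum)
    then have share: "real (\<xi> (i, j)) \<le> demand_fraction I \<xi> i j * (\<Sum>v\<in>V. real (s v i))"
      using assms that by (intro demand_le_proportional_share)
    have "x (\<zeta> i) (\<zeta> j) l \<in> {0, 1}"
      using assms that by (auto simp: first_stage_def dests_def image_subset_iff)
    then have "real (\<xi> (i, j) * x (\<zeta> i) (\<zeta> j) l) \<le> real (\<xi> (i, j))"
      by auto
    with share show ?thesis by linarith
  qed
  moreover have "(\<Sum>(j, l)\<in>dests I i \<times> L. \<xi> (i, j) * x (\<zeta> i) (\<zeta> j) l) \<le> (\<Sum>v\<in>V. s v i)"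
    using ample sum_demand_caps[OF xs \<open>\<zeta> ` I \<subseteq> Z\<close> \<open>i \<in> I\<close>, of \<xi>] by simp
  ultimately show ?thesis
    by (simp add: recourse_feasible_def)
qed

lemma recourse_objective_mono:
  assumes "\<And>j l. j \<in> dests I i \<Longrightarrow> l \<in> L \<Longrightarrow> 0 \<le> P i j l"
    and "\<And>j l. j \<in> dests I i \<Longrightarrow> l \<in> L \<Longrightarrow> r j l \<le> u j l"
  shows "recourse_objective I L P i r \<le> recourse_objective I L P i u"
  unfolding recourse_objective_def
  using assms by (intro sum_mono mult_left_mono) auto

lemma recourse_objective_strict_mono:
  assumes "finite I" and "finite L"
    and nonneg: "\<And>j l. j \<in> dests I i \<Longrightarrow> l \<in> L \<Longrightarrow> 0 \<le> P i j l"
    and le: "\<And>j l. j \<in> dests I i \<Longrightarrow> l \<in> L \<Longrightarrow> r j l \<le> u j l"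
    and j: "j \<in> dests I i" and l: "l \<in> L" and "0 < P i j l" and "r j l < u j l"
  shows "recourse_objective I L P i r < recourse_objective I L P i u"
proof -
  have entry: "P i j' l' * real (r j' l') \<le> P i j' l' * real (u j' l')"
    if "j' \<in> dests I i" "l' \<in> L" for j' l'
    using nonneg le that by (intro mult_left_mono) auto
  have "P i j l * real (r j l) < P i j l * real (u j l)"
    using assms by (intro mult_strict_left_mono) auto
  then have "(\<Sum>l\<in>L. P i j l * real (r j l)) < (\<Sum>l\<in>L. P i j l * real (u j l))"
    using entry j l \<open>finite L\<close> by (intro sum_strict_mono_ex1) auto
  then show ?thesis
    unfolding recourse_objective_def
    using entry j \<open>finite I\<close> by (intro sum_strict_mono_ex1) (auto intro: sum_mono simp: finite_dests)
qed

theorem propositionA1: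
  fixes I :: "'i set" and Z :: "'z set" and L :: "'l set" and V :: "'v set"
    and \<zeta> :: "'i \<Rightarrow> 'z"
    and P :: "'i \<Rightarrow> 'i \<Rightarrow> 'l \<Rightarrow> real"
    and x :: "'z \<Rightarrow> 'z \<Rightarrow> 'l \<Rightarrow> nat"
    and s :: "'v \<Rightarrow> 'i \<Rightarrow> nat"
    and \<xi> :: "'i \<times> 'i \<Rightarrow> nat"
    and ihat :: 'i
  assumes "finite I" and "finite Z" and "finite L" and "finite V"
    and "\<zeta> ` I \<subseteq> Z"
    and price_nonneg: "\<forall>(i, j)\<in>arcs I. \<forall>l\<in>L. 0 \<le> P i j l"
    and "(x, s) \<in> first_stage I Z L V"
    and "ihat \<in> I"
    and "(\<Sum>v\<in>V. s v ihat) \<ge> (\<Sum>j\<in>{j. (ihat, j) \<in> arcs I}. \<xi> (ihat, j))"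
  shows "recourse_optimal I L V \<zeta> P x s \<xi> ihat (\<lambda>j l. \<xi> (ihat, j) * x (\<zeta> ihat) (\<zeta> j) l) \<and>
    (\<forall>r. recourse_optimal I L V \<zeta> P x s \<xi> ihat r \<longrightarrow>
      (\<forall>j\<in>dests I ihat. \<forall>l\<in>L. 0 < P ihat j l \<longrightarrow>
        r j l = \<xi> (ihat, j) * x (\<zeta> ihat) (\<zeta> j) l))"
proof -
  let ?u = "\<lambda>j l. \<xi> (ihat, j) * x (\<zeta> ihat) (\<zeta> j) l"
  let ?F = "recourse_feasible I L V \<zeta> x s \<xi> ihat"
  let ?obj = "recourse_objective I L P ihat"
  have "{j. (ihat, j) \<in> arcs I} = dests I ihat"
    by (auto simp: dests_def arcs_def)
  with assms have u: "?u \<in> ?F"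
    by (intro demand_caps_feasible) auto
  have nonneg: "0 \<le> P ihat j l" if "j \<in> dests I ihat" "l \<in> L" for j l
    using price_nonneg that by (auto simp: dests_def)
  have cap: "r j l \<le> ?u j l" if "r \<in> ?F" "j \<in> dests I ihat" "l \<in> L" for r j l
    using that by (simp add: recourse_feasible_def)
  have "?obj r \<le> ?obj ?u" if "r \<in> ?F" for r
    by (intro recourse_objective_mono nonneg cap that)
  then have "recourse_optimal I L V \<zeta> P x s \<xi> ihat ?u"
    using u by (force simp: recourse_optimal_def is_arg_max_def)
  moreover have "r j l = ?u j l"
    if opt: "recourse_optimal I L V \<zeta> P x s \<xi> ihat r"
      and j: "j \<in> dests I ihat" and l: "l \<in> L" and pos: "0 < P ihat j l" for r j l
  proof (rule ccontr)
    assume "r j l \<noteq> ?u j l"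
    have r: "r \<in> ?F"
      using opt by (simp add: recourse_optimal_def is_arg_max_def)
    have "r j l < ?u j l"
      using cap[OF r j l] \<open>r j l \<noteq> ?u j l\<close> by simp
    then have "?obj r < ?obj ?u"
      using \<open>finite I\<close> \<open>finite L\<close> nonneg cap[OF r] j l pos
      by (intro recourse_objective_strict_mono[where j = j and l = l])
    with opt u show False
      by (auto simp: recourse_optimal_def is_arg_max_def)
  qed
  ultimately show ?thesis
    by blast
qed

end
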